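(* Let $\mu(\sigma)\propto\exp\left(\sum_{\phi\in\Phi}\phi(\sigma)\right)$ be the Gibbs measure on $\Omega=[s]^V$ associated with a factor graph $G=(V,\Phi,E)$ with maximum degrees $\Delta=\max_{x\in V}|E[x]|$ and $\kappa=\max_{\phi\in\Phi}|S[\phi]|$. Let $g:\Omega\to\mathbb R$ be of the form $g=\sum_{\phi\in\Phi}g_\phi$, where each $g_\phi:\Omega\to\mathbb R$ depends only on the coordinates in $S[\phi]$, and let $\nu(\sigma)\propto\exp\left(\sum_{\phi\in\Phi}\phi(\sigma)+g(\sigma)\right)$. Put $\delta_\phi=\frac12\left(\sup_\Omega g_\phi-\inf_\Omega g_\phi\right)$. Suppose that $\mu$ satisfies approximate tensorization with constant $C_{\mathrm{AT}}<\infty$, i.e. for every $f:\Omega\to[0,\infty)$, $$\mathrm{Ent}_V(f)\le C_{\mathrm{AT}}\sum_{x\in V}\mu\bigl(\mathrm{Ent}_{\{x\}}f\bigr).$$ Then $$d_{\mathrm H}^2(\nu,\mu)\le d_{\mathrm{KL}}(\nu,\mu)\le\frac{C_{\mathrm{AT}}\,\Delta\,\kappa}{2}\sum_{\phi\in\Phi}\delta_\phi^2 .$$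
   Context: Fix $s\in\mathbb N$ and $[s]=\{1,\dots,s\}$. A factor graph $G=(V,\Phi,E)$ consists of a finite set $V$ (vertices), a set $E$ of unordered pairs of distinct vertices (edges), and a finite indexed collection $\Phi$ of functions $\phi:\Omega=[s]^V\to\mathbb R$ (factors); each $\phi\in\Phi$ comes with a nonempty declared scope $S[\phi]\subseteq V$ and depends only on the coordinates in $S[\phi]$. For $x\in V$, $E[x]=\{\phi\in\Phi:x\in S[\phi]\}$. For probability measures on the finite set $\Omega$: $d_{\mathrm H}(\nu,\mu)=\left(\sum_\sigma(\sqrt{\nu(\sigma)}-\sqrt{\mu(\sigma)})^2\right)^{1/2}$ and $d_{\mathrm{KL}}(\nu,\mu)=\sum_\sigma\nu(\sigma)\log(\nu(\sigma)/\mu(\sigma))$. For $A\subseteq V$ and a boundary configuration $\tau_{A^c}\in[s]^{A^c}$, $\mu_A^{\tau_{A^c}}$ is the conditional law of $\sigma_A$ under $\mu$ given $\sigma_{A^c}=\tau_{A^c}$. For $f:\Omega\to[0,\infty)$, $\mu_A^{\tau_{A^c}}(f)$ is the expectation of $f(\sigma_A\tau_{A^c})$ with $\sigma_A\sim\mu_A^{\tau_{A^c}}$, the local entropy is $(\mathrm{Ent}_Af)(\tau_{A^c})=\mu_A^{\tau_{A^c}}\left[f\log\left(f/\mu_A^{\tau_{A^c}}(f)\right)\right]$ (with $0\log 0=0$), $\mu(\mathrm{Ent}_Af)$ is its expectation under $\mu$, and $\mathrm{Ent}_V(f)=\mu\left[f\log(f/\mu(f))\right]$. *)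

theory Defs
  imports "HOL-Probability.Probability"
begin

(* A configuration in [s]^A is an extensional function, i.e. undefined outside A. *)
definition configs :: "nat \<Rightarrow> 'v set \<Rightarrow> ('v \<Rightarrow> nat) set" where
  "configs s A = A \<rightarrow>\<^sub>E {1..s}"

definition depends_only_on ::
    "(('v \<Rightarrow> nat) \<Rightarrow> real) \<Rightarrow> ('v \<Rightarrow> nat) set \<Rightarrow> 'v set \<Rightarrow> bool" where
  "depends_only_on h \<Omega> S \<longleftrightarrow>
     (\<forall>\<sigma>\<in>\<Omega>. \<forall>\<tau>\<in>\<Omega>. (\<forall>x\<in>S. \<sigma> x = \<tau> x) \<longrightarrow> h \<sigma> = h \<tau>)"

(* The indexed collection of factors is given by a set of indices together with the
   function and the declared scope attached to each index, so the same function may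
   occur several times. *)
record ('v, 'i) factor_graph =
  verts :: "'v set"
  factors :: "'i set"
  edges :: "'v set set"
  factor :: "'i \<Rightarrow> ('v \<Rightarrow> nat) \<Rightarrow> real"
  scope :: "'i \<Rightarrow> 'v set"

definition is_factor_graph :: "nat \<Rightarrow> ('v, 'i) factor_graph \<Rightarrow> bool" where
  "is_factor_graph s G \<longleftrightarrow>
     finite (verts G) \<and>
     edges G \<subseteq> {{x, y} | x y. x \<in> verts G \<and> y \<in> verts G \<and> x \<noteq> y} \<and>
     finite (factors G) \<and>
     (\<forall>i\<in>factors G. scope G i \<noteq> {} \<and> scope G i \<subseteq> verts G \<and>
        depends_only_on (factor G i) (configs s (verts G)) (scope G i))"

definition factors_at :: "('v, 'i) factor_graph \<Rightarrow> 'v \<Rightarrow> 'i set" where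
  "factors_at G x = {i \<in> factors G. x \<in> scope G i}"

(* The two maximum degrees are unspecified when there are no vertices, respectively
   no factors; in a factor graph there are then no factors at all, and sums over the
   factors vanish. *)
definition max_vertex_degree :: "('v, 'i) factor_graph \<Rightarrow> nat" where
  "max_vertex_degree G = Max ((\<lambda>x. card (factors_at G x)) ` verts G)"

definition max_factor_degree :: "('v, 'i) factor_graph \<Rightarrow> nat" where
  "max_factor_degree G = Max ((\<lambda>i. card (scope G i)) ` factors G)"

(* The probability measure on \<Omega> proportional to exp H. *)
definition gibbs :: "('v \<Rightarrow> nat) set \<Rightarrow> (('v \<Rightarrow> nat) \<Rightarrow> real) \<Rightarrow> ('v \<Rightarrow> nat) pmf" where
  "gibbs \<Omega> H =
     embed_pmf (\<lambda>\<sigma>. if \<sigma> \<in> \<Omega> then exp (H \<sigma>) / (\<Sum>\<tau>\<in>\<Omega>. exp (H \<tau>)) else 0)"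

(* The density above is normalised, so embed_pmf is used within its domain. *)
lemma pmf_gibbs:
  assumes "finite \<Omega>" "\<Omega> \<noteq> {}"
  shows "pmf (gibbs \<Omega> H) \<sigma> =
           (if \<sigma> \<in> \<Omega> then exp (H \<sigma>) / (\<Sum>\<tau>\<in>\<Omega>. exp (H \<tau>)) else 0)"
proof -
  let ?Z = "\<Sum>\<tau>\<in>\<Omega>. exp (H \<tau>)"
  let ?p = "\<lambda>\<sigma>. if \<sigma> \<in> \<Omega> then exp (H \<sigma>) / ?Z else 0"
  have Z: "?Z > 0"
    using assms by (intro sum_pos) auto
  have nonneg: "?p \<sigma> \<ge> 0" for \<sigma>
    using Z by simp
  have "(\<integral>\<^sup>+\<sigma>. ennreal (?p \<sigma>) \<partial>count_space UNIV) = (\<Sum>\<sigma>\<in>\<Omega>. ennreal (?p \<sigma>))"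
    by (rule nn_integral_count_space') (use assms in auto)
  also have "\<dots> = ennreal (\<Sum>\<sigma>\<in>\<Omega>. ?p \<sigma>)"
    by (rule sum_ennreal) (rule nonneg)
  also have "(\<Sum>\<sigma>\<in>\<Omega>. ?p \<sigma>) = 1"
    using Z by (simp flip: sum_divide_distrib)
  finally show ?thesis
    unfolding gibbs_def by (subst pmf_embed_pmf) (use nonneg in auto)
qed

definition hellinger_dist :: "'a set \<Rightarrow> 'a pmf \<Rightarrow> 'a pmf \<Rightarrow> real" where
  "hellinger_dist \<Omega> \<nu> \<mu> = sqrt (\<Sum>\<sigma>\<in>\<Omega>. (sqrt (pmf \<nu> \<sigma>) - sqrt (pmf \<mu> \<sigma>))\<^sup>2)"

definition kl_div :: "'a set \<Rightarrow> 'a pmf \<Rightarrow> 'a pmf \<Rightarrow> real" where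
  "kl_div \<Omega> \<nu> \<mu> = (\<Sum>\<sigma>\<in>\<Omega>. pmf \<nu> \<sigma> * ln (pmf \<nu> \<sigma> / pmf \<mu> \<sigma>))"

(* The law on [s]^A of \<sigma> restricted to A, given that \<sigma> agrees with \<tau> on V - A; here \<tau>
   is a configuration on V - A that has positive probability. *)
definition cond_law ::
    "'v set \<Rightarrow> ('v \<Rightarrow> nat) pmf \<Rightarrow> 'v set \<Rightarrow> ('v \<Rightarrow> nat) \<Rightarrow> ('v \<Rightarrow> nat) pmf" where
  "cond_law V \<mu> A \<tau> =
     map_pmf (\<lambda>\<sigma>. restrict \<sigma> A) (cond_pmf \<mu> {\<sigma>. restrict \<sigma> (V - A) = \<tau>})"

definition cond_mean ::
    "'v set \<Rightarrow> ('v \<Rightarrow> nat) pmf \<Rightarrow> 'v set \<Rightarrow> ('v \<Rightarrow> nat) \<Rightarrow> (('v \<Rightarrow> nat) \<Rightarrow> real) \<Rightarrow> real" where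
  "cond_mean V \<mu> A \<tau> f =
     measure_pmf.expectation (cond_law V \<mu> A \<tau>) (\<lambda>\<eta>. f (merge A (V - A) (\<eta>, \<tau>)))"

(* Here and below ln 0 = 0 and 0 / 0 = 0 give the convention 0 log 0 = 0. *)
definition local_ent ::
    "'v set \<Rightarrow> ('v \<Rightarrow> nat) pmf \<Rightarrow> 'v set \<Rightarrow> (('v \<Rightarrow> nat) \<Rightarrow> real) \<Rightarrow> ('v \<Rightarrow> nat) \<Rightarrow> real" where
  "local_ent V \<mu> A f \<tau> =
     cond_mean V \<mu> A \<tau> (\<lambda>\<sigma>. f \<sigma> * ln (f \<sigma> / cond_mean V \<mu> A \<tau> f))"

definition mean_local_ent ::
    "'v set \<Rightarrow> ('v \<Rightarrow> nat) pmf \<Rightarrow> 'v set \<Rightarrow> (('v \<Rightarrow> nat) \<Rightarrow> real) \<Rightarrow> real" where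
  "mean_local_ent V \<mu> A f =
     measure_pmf.expectation \<mu> (\<lambda>\<sigma>. local_ent V \<mu> A f (restrict \<sigma> (V - A)))"

definition global_ent :: "('v \<Rightarrow> nat) pmf \<Rightarrow> (('v \<Rightarrow> nat) \<Rightarrow> real) \<Rightarrow> real" where
  "global_ent \<mu> f =
     measure_pmf.expectation \<mu> (\<lambda>\<sigma>. f \<sigma> * ln (f \<sigma> / measure_pmf.expectation \<mu> f))"

definition approx_tensorization ::
    "nat \<Rightarrow> 'v set \<Rightarrow> ('v \<Rightarrow> nat) pmf \<Rightarrow> real \<Rightarrow> bool" where
  "approx_tensorization s V \<mu> C \<longleftrightarrow>
     (\<forall>f. (\<forall>\<sigma>\<in>configs s V. 0 \<le> f \<sigma>) \<longrightarrow>
        global_ent \<mu> f \<le> C * (\<Sum>x\<in>V. mean_local_ent V \<mu> {x} f))"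

definition half_osc :: "('v \<Rightarrow> nat) set \<Rightarrow> (('v \<Rightarrow> nat) \<Rightarrow> real) \<Rightarrow> real" where
  "half_osc \<Omega> h = ((SUP \<sigma>\<in>\<Omega>. h \<sigma>) - (INF \<sigma>\<in>\<Omega>. h \<sigma>)) / 2"

end

theory Submission
  imports Defs
begin

text \<open>The relative entropy of \<open>\<nu>\<close> is the global entropy of the density \<open>f = d\<nu>/d\<mu>\<close>, to which
  approximate tensorization applies. The conditional law of \<open>\<nu>\<close> at a vertex \<open>x\<close> is an exponential
  tilt of that of \<open>\<mu>\<close> by a function whose half-oscillation is at most the sum of the \<open>\<delta>\<^sub>\<phi>\<close> over the
  factors \<open>\<phi>\<close> at \<open>x\<close>, so Hoeffding's lemma bounds each local entropy by half the square of this sum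
  times the conditional mean of \<open>f\<close>. Averaging over \<open>\<mu>\<close>, where \<open>f\<close> has mean 1, and applying
  Cauchy-Schwarz over the factors at each vertex gives the upper bound. The lower bound follows
  from \<open>ln t \<le> t - 1\<close> at the square root of \<open>d\<mu>/d\<nu>\<close>.\<close>

section \<open>Expectations under finitely supported laws\<close>

lemma expectation_finite:
  fixes p :: "'a pmf" and f :: "'a \<Rightarrow> real"
  assumes "finite (set_pmf p)"
  shows "measure_pmf.expectation p f = (\<Sum>\<sigma>\<in>set_pmf p. pmf p \<sigma> * f \<sigma>)"
  using assms by (subst integral_measure_pmf[of "set_pmf p"]) auto

lemma expectation_cong_set_pmf:
  fixes p :: "'a pmf" and f g :: "'a \<Rightarrow> real"
  assumes "\<And>\<sigma>. \<sigma> \<in> set_pmf p \<Longrightarrow> f \<sigma> = g \<sigma>"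
  shows "measure_pmf.expectation p f = measure_pmf.expectation p g"
  using assms by (intro integral_cong_AE) (auto simp: AE_measure_pmf_iff)

lemma expectation_mono_set_pmf:
  fixes p :: "'a pmf" and f g :: "'a \<Rightarrow> real"
  assumes "finite (set_pmf p)" "\<And>\<sigma>. \<sigma> \<in> set_pmf p \<Longrightarrow> f \<sigma> \<le> g \<sigma>"
  shows "measure_pmf.expectation p f \<le> measure_pmf.expectation p g"
  using assms by (intro integral_mono_AE integrable_measure_pmf_finite) (auto simp: AE_measure_pmf_iff)

lemma expectation_pos:
  fixes p :: "'a pmf" and f :: "'a \<Rightarrow> real"
  assumes "finite (set_pmf p)" "\<And>\<sigma>. \<sigma> \<in> set_pmf p \<Longrightarrow> 0 < f \<sigma>"
  shows "0 < measure_pmf.expectation p f"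
  using assms set_pmf_not_empty[of p]
  by (auto simp: expectation_finite pmf_positive_iff intro!: sum_pos)

section \<open>Entropy under a single law\<close>

lemma global_ent_nonneg:
  fixes p :: "('v \<Rightarrow> nat) pmf"
  assumes fin: "finite (set_pmf p)" and f: "\<And>\<sigma>. \<sigma> \<in> set_pmf p \<Longrightarrow> 0 \<le> f \<sigma>"
  shows "0 \<le> global_ent p f"
proof -
  define m where "m = measure_pmf.expectation p f"
  have "0 \<le> m"
    unfolding m_def using f by (intro integral_nonneg_AE) (auto simp: AE_measure_pmf_iff)
  show ?thesis
  proof (cases "m = 0")
    \<comment> \<open>With \<open>m = 0\<close> the quotient \<open>f \<sigma> / m\<close> is 0 and
      so is its logarithm, hence the integrand vanishes identically.\<close>
    case True
    then show ?thesis by (simp add: global_ent_def flip: m_def)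
  next
    case False
    with \<open>0 \<le> m\<close> have m: "0 < m" by simp
    \<comment> \<open>The bound is \<open>ln t \<le> t - 1\<close> at
      \<open>t = m / f \<sigma>\<close>; its left side has mean zero because \<open>m\<close> is the
      mean of \<open>f\<close>.\<close>
    have *: "f \<sigma> - m \<le> f \<sigma> * ln (f \<sigma> / m)" if "\<sigma> \<in> set_pmf p" for \<sigma>
    proof (cases "f \<sigma> = 0")
      case True
      then show ?thesis using m by simp
    next
      case False
      with f[OF that] have "0 < f \<sigma>" by simp
      then have "f \<sigma> * ln (m / f \<sigma>) \<le> f \<sigma> * (m / f \<sigma> - 1)"
        using m by (intro mult_left_mono ln_le_minus_one) auto
      also have "\<dots> = m - f \<sigma>"
        using \<open>0 < f \<sigma>\<close> by (simp add: field_simps)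
      finally show ?thesis
        using \<open>0 < f \<sigma>\<close> m by (simp add: ln_div algebra_simps)
    qed
    have "0 = measure_pmf.expectation p (\<lambda>\<sigma>. f \<sigma> - m)"
      by (simp add: m_def Bochner_Integration.integral_diff integrable_measure_pmf_finite[OF fin])
    also have "\<dots> \<le> measure_pmf.expectation p (\<lambda>\<sigma>. f \<sigma> * ln (f \<sigma> / m))"
      using fin * by (rule expectation_mono_set_pmf)
    finally show ?thesis by (simp add: global_ent_def m_def)
  qed
qed

text \<open>The relative entropy of the exponentially tilted law \<open>q\<close> with respect to \<open>p\<close> is the
  cumulant generating function of \<open>-h\<close> centred under \<open>q\<close>, which Hoeffding's lemma bounds.\<close>

lemma global_ent_exp_le:
  fixes p :: "('v \<Rightarrow> nat) pmf"
  assumes fin: "finite (set_pmf p)"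
    and osc: "\<And>\<sigma> \<tau>. \<sigma> \<in> set_pmf p \<Longrightarrow> \<tau> \<in> set_pmf p \<Longrightarrow> h \<sigma> - h \<tau> \<le> 2 * d"
  shows "global_ent p (\<lambda>\<sigma>. exp (h \<sigma>)) \<le> d\<^sup>2 / 2 * measure_pmf.expectation p (\<lambda>\<sigma>. exp (h \<sigma>))"
proof -
  let ?S = "set_pmf p"
  define m where "m = measure_pmf.expectation p (\<lambda>\<sigma>. exp (h \<sigma>))"
  have m: "0 < m" unfolding m_def using fin by (rule expectation_pos) simp
  \<comment> \<open>The tilt of \<open>p\<close> by \<open>exp h\<close>. Writing the weights of
    \<open>p\<close> as exponentials on the support lets \<open>pmf_gibbs\<close> supply the
    normalisation, whose constant is \<open>m\<close>.\<close>
  define q where "q = gibbs ?S (\<lambda>\<sigma>. ln (pmf p \<sigma>) + h \<sigma>)"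
  have "(\<Sum>\<tau>\<in>?S. exp (ln (pmf p \<tau>) + h \<tau>)) = m"
    by (simp add: m_def expectation_finite[OF fin] exp_add pmf_positive cong: sum.cong)
  then have q: "pmf q \<sigma> = pmf p \<sigma> * exp (h \<sigma>) / m" for \<sigma>
    using fin set_pmf_not_empty[of p]
    by (simp add: q_def pmf_gibbs exp_add pmf_positive pmf_eq_0_set_pmf)
  have set_q: "set_pmf q = ?S"
    using m by (auto simp: set_pmf_eq q)
  have fin_q: "finite (set_pmf q)" by (simp add: set_q fin)
  have q_exp: "measure_pmf.expectation q k = measure_pmf.expectation p (\<lambda>\<sigma>. exp (h \<sigma>) * k \<sigma>) / m" for k
    by (simp add: expectation_finite fin fin_q set_q q sum_divide_distrib mult_ac)
  define e where "e = measure_pmf.expectation q h"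
  define a where "a = Min ((\<lambda>\<sigma>. - h \<sigma>) ` ?S)"
  define b where "b = Max ((\<lambda>\<sigma>. - h \<sigma>) ` ?S)"
  have ne: "?S \<noteq> {}" by (rule set_pmf_not_empty)
  have ab: "a \<le> - h \<sigma>" "- h \<sigma> \<le> b" if "\<sigma> \<in> ?S" for \<sigma>
    using fin that by (auto simp: a_def b_def)
  \<comment> \<open>Both extremes are attained, so \<open>b - a\<close> is itself a difference of
    two values of \<open>h\<close> on the support and \<open>osc\<close> applies to it.\<close>
  have "a \<in> (\<lambda>\<sigma>. - h \<sigma>) ` ?S" "b \<in> (\<lambda>\<sigma>. - h \<sigma>) ` ?S"
    unfolding a_def b_def using fin ne by (intro Min_in Max_in; simp)+
  then have ba: "b - a \<le> 2 * d" "0 \<le> b - a"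
    using osc ab by fastforce+
  interpret interval_bounded_random_variable "measure_pmf q" "\<lambda>\<sigma>. - h \<sigma>" a b
    by unfold_locales (use ab in \<open>auto simp: AE_measure_pmf_iff set_q\<close>)
  \<comment> \<open>Hoeffding's lemma is used at parameter 1 for \<open>- h\<close>, whose mean
    under \<open>q\<close> is \<open>- e\<close>.\<close>
  have "ennreal (measure_pmf.expectation q (\<lambda>\<sigma>. exp (e - h \<sigma>)))
      = (\<integral>\<^sup>+\<sigma>. ennreal (exp (e - h \<sigma>)) \<partial>q)"
    by (intro nn_integral_eq_integral[symmetric] integrable_measure_pmf_finite fin_q) auto
  also have "\<dots> = (\<integral>\<^sup>+\<sigma>. exp (1 * (- h \<sigma> - measure_pmf.expectation q (\<lambda>\<sigma>. - h \<sigma>))) \<partial>q)"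
    by (simp add: e_def algebra_simps)
  also have "\<dots> \<le> ennreal (exp (1\<^sup>2 * (b - a)\<^sup>2 / 8))"
    by (rule Hoeffdings_lemma_nn_integral) simp
  finally have "measure_pmf.expectation q (\<lambda>\<sigma>. exp (e - h \<sigma>)) \<le> exp ((b - a)\<^sup>2 / 8)"
    by simp
  \<comment> \<open>The weight \<open>exp (h \<sigma>)\<close> of the tilt cancels against
    \<open>exp (- h \<sigma>)\<close>, leaving only \<open>exp e / m\<close>.\<close>
  moreover have "measure_pmf.expectation q (\<lambda>\<sigma>. exp (e - h \<sigma>)) = exp (e - ln m)"
    using m by (simp add: q_exp exp_diff)
  ultimately have "e - ln m \<le> (b - a)\<^sup>2 / 8" by simp
  also have "\<dots> \<le> (2 * d)\<^sup>2 / 8"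
    using ba by (intro divide_right_mono power_mono) auto
  finally have *: "e - ln m \<le> d\<^sup>2 / 2" by (simp add: power_mult_distrib)
  \<comment> \<open>Since \<open>q\<close> has density \<open>exp h / m\<close> with respect to
    \<open>p\<close>, this quantity is the relative entropy of \<open>q\<close>, that is, the
    entropy of \<open>exp h\<close> divided by its mean.\<close>
  have "e - ln m = measure_pmf.expectation q (\<lambda>\<sigma>. h \<sigma> - ln m)"
    by (simp add: e_def integrable_measure_pmf_finite[OF fin_q])
  also have "\<dots> = global_ent p (\<lambda>\<sigma>. exp (h \<sigma>)) / m"
    using m by (simp add: q_exp global_ent_def ln_div flip: m_def)
  finally show ?thesis
    using * m by (simp add: pos_divide_le_eq flip: m_def)
qed

section \<open>Conditional laws and mean local entropies\<close>

lemma configs_merge: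
  assumes "\<sigma> \<in> configs s V" "A \<subseteq> V"
  shows "merge A (V - A) (\<sigma>, \<sigma>) = \<sigma>"
  using assms by (auto simp: configs_def Un_absorb1 PiE_restrict)

text \<open>Every configuration in the support of \<open>p\<close> agrees with
  \<open>\<sigma>\<close> off \<open>A\<close>, so gluing its restriction to \<open>A\<close> onto
  the boundary condition gives it back. Local quantities thus become ordinary ones under a law on
  whole configurations.\<close>

lemma
  fixes \<mu> :: "('v \<Rightarrow> nat) pmf"
  assumes \<mu>: "set_pmf \<mu> \<subseteq> configs s V" and A: "A \<subseteq> V" and \<sigma>: "\<sigma> \<in> set_pmf \<mu>"
  defines "p \<equiv> cond_pmf \<mu> {\<tau>. restrict \<tau> (V - A) = restrict \<sigma> (V - A)}"
  shows cond_mean_eq: "cond_mean V \<mu> A (restrict \<sigma> (V - A)) f = measure_pmf.expectation p f"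
    and local_ent_eq: "local_ent V \<mu> A f (restrict \<sigma> (V - A)) = global_ent p f"
proof -
  have set_p: "set_pmf p = set_pmf \<mu> \<inter> {\<tau>. restrict \<tau> (V - A) = restrict \<sigma> (V - A)}"
    unfolding p_def using \<sigma> by (intro set_cond_pmf) auto
  have "merge A (V - A) (restrict \<tau> A, restrict \<sigma> (V - A)) = \<tau>" if "\<tau> \<in> set_pmf p" for \<tau>
  proof -
    have "merge A (V - A) (restrict \<tau> A, restrict \<sigma> (V - A))
        = merge A (V - A) (restrict \<tau> A, restrict \<tau> (V - A))"
      using that by (simp only: set_p) simp
    also have "\<dots> = \<tau>"
      unfolding merge_restrict using that \<mu> A by (intro configs_merge[of _ s]) (auto simp: set_p)
    finally show ?thesis .
  qed
  then show *: "cond_mean V \<mu> A (restrict \<sigma> (V - A)) f = measure_pmf.expectation p f" for f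
    unfolding cond_mean_def cond_law_def p_def[symmetric] integral_map_pmf
    by (intro expectation_cong_set_pmf) simp
  show "local_ent V \<mu> A f (restrict \<sigma> (V - A)) = global_ent p f"
    by (simp only: local_ent_def global_ent_def *)
qed

lemma mean_local_ent_eq:
  fixes \<mu> :: "('v \<Rightarrow> nat) pmf"
  assumes "set_pmf \<mu> \<subseteq> configs s V" "A \<subseteq> V"
  shows "mean_local_ent V \<mu> A f = measure_pmf.expectation \<mu> (\<lambda>\<sigma>.
    global_ent (cond_pmf \<mu> {\<tau>. restrict \<tau> (V - A) = restrict \<sigma> (V - A)}) f)"
  unfolding mean_local_ent_def using assms
  by (intro expectation_cong_set_pmf local_ent_eq)

text \<open>Tower property: drawing from \<open>\<mu>\<close> and then resampling within the same
  fibre of \<open>r\<close> reproduces \<open>\<mu>\<close>.\<close>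

lemma expectation_cond_pmf:
  fixes \<mu> :: "'a pmf" and f :: "'a \<Rightarrow> real"
  assumes fin: "finite (set_pmf \<mu>)"
  shows "measure_pmf.expectation \<mu> (\<lambda>\<sigma>. measure_pmf.expectation (cond_pmf \<mu> {\<tau>. r \<tau> = r \<sigma>}) f)
    = measure_pmf.expectation \<mu> f"
proof -
  have set_p: "set_pmf (cond_pmf \<mu> {\<tau>. r \<tau> = r \<sigma>}) = set_pmf \<mu> \<inter> {\<tau>. r \<tau> = r \<sigma>}" if "\<sigma> \<in> set_pmf \<mu>" for \<sigma>
    using that by (intro set_cond_pmf) auto
  have "bind_pmf \<mu> (\<lambda>\<sigma>. cond_pmf \<mu> {\<tau>. r \<tau> = r \<sigma>}) = \<mu>"
  proof (rule bind_cond_pmf_cancel)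
    show "measure \<mu> {y. r y = r x} = measure \<mu> {x. r y = r x}" if "r y = r x" for x y
      using that by (simp add: eq_commute)
  qed auto
  then have "measure_pmf.expectation \<mu> f
      = measure_pmf.expectation (bind_pmf \<mu> (\<lambda>\<sigma>. cond_pmf \<mu> {\<tau>. r \<tau> = r \<sigma>})) f"
    by simp
  also have "\<dots> = (\<Sum>\<sigma>\<in>set_pmf \<mu>. pmf \<mu> \<sigma> *\<^sub>R measure_pmf.expectation (cond_pmf \<mu> {\<tau>. r \<tau> = r \<sigma>}) f)"
    using fin by (intro pmf_expectation_bind) (auto simp: set_p)
  finally show ?thesis by (subst expectation_finite[OF fin]) simp
qed

lemma mean_local_ent_nonneg:
  fixes \<mu> :: "('v \<Rightarrow> nat) pmf"
  assumes \<mu>: "set_pmf \<mu> \<subseteq> configs s V" and A: "A \<subseteq> V" and fin: "finite (set_pmf \<mu>)"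
    and f: "\<And>\<sigma>. \<sigma> \<in> set_pmf \<mu> \<Longrightarrow> 0 \<le> f \<sigma>"
  shows "0 \<le> mean_local_ent V \<mu> A f"
  unfolding mean_local_ent_eq[OF \<mu> A]
proof (intro integral_nonneg_AE, unfold AE_measure_pmf_iff, intro ballI)
  fix \<sigma> assume \<sigma>: "\<sigma> \<in> set_pmf \<mu>"
  have "set_pmf (cond_pmf \<mu> {\<tau>. restrict \<tau> (V - A) = restrict \<sigma> (V - A)}) \<subseteq> set_pmf \<mu>"
    by (subst set_cond_pmf) (use \<sigma> in auto)
  then show "0 \<le> global_ent (cond_pmf \<mu> {\<tau>. restrict \<tau> (V - A) = restrict \<sigma> (V - A)}) f"
    using fin f by (intro global_ent_nonneg) (auto intro: finite_subset)
qed

text \<open>Two configurations in the support of one conditional law differ only on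
  \<open>A\<close>, so \<open>osc\<close> controls \<open>h\<close> there. The bound for a single
  law applies to each conditional law, and the tower property turns the averaged conditional means
  into the global mean.\<close>

lemma mean_local_ent_exp_le:
  fixes \<mu> :: "('v \<Rightarrow> nat) pmf"
  assumes \<mu>: "set_pmf \<mu> \<subseteq> configs s V" and A: "A \<subseteq> V" and fin: "finite (set_pmf \<mu>)"
    and osc: "\<And>\<sigma> \<tau>. \<sigma> \<in> configs s V \<Longrightarrow> \<tau> \<in> configs s V \<Longrightarrow> (\<forall>y\<in>V - A. \<sigma> y = \<tau> y)
      \<Longrightarrow> h \<sigma> - h \<tau> \<le> 2 * d"
  shows "mean_local_ent V \<mu> A (\<lambda>\<sigma>. exp (h \<sigma>))
    \<le> d\<^sup>2 / 2 * measure_pmf.expectation \<mu> (\<lambda>\<sigma>. exp (h \<sigma>))"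
proof -
  define r where "r = (\<lambda>\<sigma>::'v \<Rightarrow> nat. restrict \<sigma> (V - A))"
  have r: "\<forall>y\<in>V - A. \<sigma> y = \<tau> y" if "r \<sigma> = r \<tau>" for \<sigma> \<tau>
    using that unfolding r_def by (metis restrict_apply')
  have set_p: "set_pmf (cond_pmf \<mu> {\<tau>. r \<tau> = r \<sigma>}) = set_pmf \<mu> \<inter> {\<tau>. r \<tau> = r \<sigma>}" if "\<sigma> \<in> set_pmf \<mu>" for \<sigma>
    using that by (intro set_cond_pmf) auto
  have "mean_local_ent V \<mu> A (\<lambda>\<sigma>. exp (h \<sigma>))
      = measure_pmf.expectation \<mu> (\<lambda>\<sigma>. global_ent (cond_pmf \<mu> {\<tau>. r \<tau> = r \<sigma>}) (\<lambda>\<sigma>. exp (h \<sigma>)))"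
    unfolding r_def by (rule mean_local_ent_eq[OF \<mu> A])
  also have "\<dots> \<le> measure_pmf.expectation \<mu> (\<lambda>\<sigma>. d\<^sup>2 / 2 *
      measure_pmf.expectation (cond_pmf \<mu> {\<tau>. r \<tau> = r \<sigma>}) (\<lambda>\<sigma>. exp (h \<sigma>)))"
    using fin \<mu>
    by (intro expectation_mono_set_pmf global_ent_exp_le osc r) (auto simp: set_p)
  also have "\<dots> = d\<^sup>2 / 2 * measure_pmf.expectation \<mu> (\<lambda>\<sigma>. exp (h \<sigma>))"
    by (simp only: integral_mult_right_zero expectation_cond_pmf[OF fin])
  finally show ?thesis .
qed

section \<open>Hellinger distance against relative entropy\<close>

lemma hellinger_dist_sq_le_kl_div:
  assumes pos: "\<And>\<sigma>. \<sigma> \<in> \<Omega> \<Longrightarrow> 0 < pmf \<nu> \<sigma> \<and> 0 < pmf \<mu> \<sigma>"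
    and sum: "(\<Sum>\<sigma>\<in>\<Omega>. pmf \<nu> \<sigma>) = (\<Sum>\<sigma>\<in>\<Omega>. pmf \<mu> \<sigma>)"
  shows "(hellinger_dist \<Omega> \<nu> \<mu>)\<^sup>2 \<le> kl_div \<Omega> \<nu> \<mu>"
proof -
  \<comment> \<open>The added difference of masses makes the inequality true pointwise; by
    \<open>sum\<close> it contributes nothing in total.\<close>
  have *: "(sqrt (pmf \<nu> \<sigma>) - sqrt (pmf \<mu> \<sigma>))\<^sup>2
      \<le> pmf \<nu> \<sigma> * ln (pmf \<nu> \<sigma> / pmf \<mu> \<sigma>) + (pmf \<mu> \<sigma> - pmf \<nu> \<sigma>)" if "\<sigma> \<in> \<Omega>" for \<sigma>
  proof -
    define a where "a = sqrt (pmf \<nu> \<sigma>)"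
    define b where "b = sqrt (pmf \<mu> \<sigma>)"
    have ab: "0 < a" "0 < b" "pmf \<nu> \<sigma> = a\<^sup>2" "pmf \<mu> \<sigma> = b\<^sup>2"
      using pos[OF that] by (auto simp: a_def b_def)
    have "2 * a\<^sup>2 * ln (b / a) \<le> 2 * a\<^sup>2 * (b / a - 1)"
      using ab by (intro mult_left_mono ln_le_minus_one) auto
    also have "\<dots> = 2 * a * b - 2 * a\<^sup>2"
      using ab by (simp add: field_simps power2_eq_square)
    finally have "(a - b)\<^sup>2 \<le> a\<^sup>2 * ln (a\<^sup>2 / b\<^sup>2) + (b\<^sup>2 - a\<^sup>2)"
      using ab(1,2) by (simp add: ln_div ln_realpow power2_diff algebra_simps)
    then show ?thesis unfolding ab(3,4) using ab(1,2) by simp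
  qed
  have "(hellinger_dist \<Omega> \<nu> \<mu>)\<^sup>2 = (\<Sum>\<sigma>\<in>\<Omega>. (sqrt (pmf \<nu> \<sigma>) - sqrt (pmf \<mu> \<sigma>))\<^sup>2)"
    by (simp add: hellinger_dist_def sum_nonneg)
  also have "\<dots> \<le> (\<Sum>\<sigma>\<in>\<Omega>. pmf \<nu> \<sigma> * ln (pmf \<nu> \<sigma> / pmf \<mu> \<sigma>) + (pmf \<mu> \<sigma> - pmf \<nu> \<sigma>))"
    by (intro sum_mono *)
  also have "\<dots> = kl_div \<Omega> \<nu> \<mu>"
    by (simp add: sum.distrib sum_subtractf sum kl_div_def)
  finally show ?thesis .
qed

section \<open>Oscillation, sign of the tensorization constant, and sums over scopes\<close>

lemma half_osc_bound:
  assumes "finite \<Omega>" "\<sigma> \<in> \<Omega>" "\<tau> \<in> \<Omega>"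
  shows "h \<sigma> - h \<tau> \<le> 2 * half_osc \<Omega> h"
proof -
  have "h \<sigma> \<le> (SUP \<sigma>\<in>\<Omega>. h \<sigma>)" "(INF \<sigma>\<in>\<Omega>. h \<sigma>) \<le> h \<tau>"
    using assms by (auto intro!: cSUP_upper cINF_lower)
  then show ?thesis by (simp add: half_osc_def)
qed

text \<open>The indicator of a configuration has positive entropy, whereas local entropies are never
  negative.\<close>

lemma approx_tensorization_nonneg:
  assumes AT: "approx_tensorization s V \<mu> C"
    and \<mu>: "set_pmf \<mu> = configs s V" and fin: "finite (configs s V)"
    and \<sigma>: "\<sigma> \<in> configs s V" "\<tau> \<in> configs s V" "\<sigma> \<noteq> \<tau>"
  shows "0 \<le> C"
proof (rule ccontr)
  assume C: "\<not> 0 \<le> C"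
  define f where "f = (\<lambda>\<eta>::'a \<Rightarrow> nat. indicator {\<sigma>} \<eta> :: real)"
  define w where "w = pmf \<mu> \<sigma>"
  have w: "0 < w" using \<sigma> \<mu> by (auto simp: w_def pmf_positive_iff)
  \<comment> \<open>The second configuration takes some of the mass, which makes
    \<open>w < 1\<close> and the entropy \<open>w * ln (1 / w)\<close> strictly positive.\<close>
  have "0 < pmf \<mu> \<tau>" using \<sigma> \<mu> by (auto simp: pmf_positive_iff)
  moreover have "w + pmf \<mu> \<tau> = measure \<mu> {\<sigma>, \<tau>}"
    using \<sigma> by (simp add: w_def measure_measure_pmf_finite)
  moreover have "\<dots> \<le> 1" by simp
  ultimately have "w < 1" by linarith
  have Ef: "measure_pmf.expectation \<mu> f = w"
    by (simp add: f_def w_def measure_pmf_single)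
  have "global_ent \<mu> f = measure_pmf.expectation \<mu> (\<lambda>\<eta>. indicator {\<sigma>} \<eta> * ln (1 / w))"
    unfolding global_ent_def Ef by (intro expectation_cong_set_pmf) (auto simp: f_def indicator_def)
  also have "\<dots> = w * ln (1 / w)"
    by (simp add: w_def measure_pmf_single)
  also have "\<dots> > 0" using w \<open>w < 1\<close> by (intro mult_pos_pos ln_gt_zero) auto
  finally have "0 < global_ent \<mu> f" .
  also have "\<dots> \<le> C * (\<Sum>x\<in>V. mean_local_ent V \<mu> {x} f)"
    using AT by (simp add: approx_tensorization_def f_def)
  also have "\<dots> \<le> 0"
    using C \<mu> fin
    by (intro mult_nonpos_nonneg sum_nonneg mean_local_ent_nonneg[of _ s]) (auto simp: f_def)
  finally show False by simp
qed

text \<open>Cauchy-Schwarz at each vertex costs the vertex degree; after exchanging the sums, each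
  factor is counted once per vertex of its scope, which costs the factor degree. Each maximum is
  compared only with its own entries, so its value on an empty set never matters.\<close>

lemma sum_over_scopes_le:
  fixes d :: "'i \<Rightarrow> real"
  assumes G: "is_factor_graph s G"
  shows "(\<Sum>x\<in>verts G. (\<Sum>i\<in>factors_at G x. d i)\<^sup>2)
    \<le> real (max_vertex_degree G) * real (max_factor_degree G) * (\<Sum>i\<in>factors G. (d i)\<^sup>2)"
proof -
  have fin: "finite (verts G)" "finite (factors G)" and sc: "\<And>i. i \<in> factors G \<Longrightarrow> scope G i \<subseteq> verts G"
    using G by (auto simp: is_factor_graph_def)
  have "(\<Sum>x\<in>verts G. (\<Sum>i\<in>factors_at G x. d i)\<^sup>2)
      \<le> (\<Sum>x\<in>verts G. real (max_vertex_degree G) * (\<Sum>i\<in>factors_at G x. (d i)\<^sup>2))"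
  proof (rule sum_mono)
    fix x assume x: "x \<in> verts G"
    have "card (factors_at G x) \<le> max_vertex_degree G"
      unfolding max_vertex_degree_def using fin x by (intro Max_ge) auto
    moreover have "(\<Sum>i\<in>factors_at G x. d i)\<^sup>2 \<le> real (card (factors_at G x)) * (\<Sum>i\<in>factors_at G x. (d i)\<^sup>2)"
      using sum_squared_le_sum_of_squares[of d "factors_at G x"] by (simp add: mult.commute)
    ultimately show "(\<Sum>i\<in>factors_at G x. d i)\<^sup>2
        \<le> real (max_vertex_degree G) * (\<Sum>i\<in>factors_at G x. (d i)\<^sup>2)"
      by (meson mult_right_mono of_nat_mono order_trans sum_nonneg zero_le_power2)
  qed
  also have "\<dots> = real (max_vertex_degree G) * (\<Sum>x\<in>verts G. \<Sum>i | i \<in> factors G \<and> x \<in> scope G i. (d i)\<^sup>2)"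
    by (simp add: sum_distrib_left factors_at_def)
  also have "(\<Sum>x\<in>verts G. \<Sum>i | i \<in> factors G \<and> x \<in> scope G i. (d i)\<^sup>2)
      = (\<Sum>i\<in>factors G. \<Sum>x | x \<in> verts G \<and> x \<in> scope G i. (d i)\<^sup>2)"
    using fin by (intro sum.swap_restrict)
  also have "\<dots> \<le> (\<Sum>i\<in>factors G. real (max_factor_degree G) * (d i)\<^sup>2)"
  proof (rule sum_mono)
    fix i assume i: "i \<in> factors G"
    have "{x. x \<in> verts G \<and> x \<in> scope G i} = scope G i" using sc[OF i] by auto
    moreover have "card (scope G i) \<le> max_factor_degree G"
      unfolding max_factor_degree_def using fin i by (intro Max_ge) auto
    ultimately show "(\<Sum>x | x \<in> verts G \<and> x \<in> scope G i. (d i)\<^sup>2) \<le> real (max_factor_degree G) * (d i)\<^sup>2"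
      by (simp add: mult_right_mono)
  qed
  finally show ?thesis
    by (simp add: mult_left_mono mult.assoc flip: sum_distrib_left)
qed

section \<open>The bounds for the perturbed Gibbs measure\<close>

theorem theorem3p1:
  fixes s :: nat
    and G :: "('v, 'i) factor_graph"
    and \<Omega> :: "('v \<Rightarrow> nat) set"
    and \<mu> \<nu> :: "('v \<Rightarrow> nat) pmf"
    and g :: "('v \<Rightarrow> nat) \<Rightarrow> real"
    and g\<^sub>\<Phi> :: "'i \<Rightarrow> ('v \<Rightarrow> nat) \<Rightarrow> real"
    and C\<^sub>A\<^sub>T :: real
  assumes s: "1 \<le> s"
    and G: "is_factor_graph s G"
    and \<Omega>: "\<Omega> = configs s (verts G)"
    and \<mu>: "\<mu> = gibbs \<Omega> (\<lambda>\<sigma>. \<Sum>i\<in>factors G. factor G i \<sigma>)"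
    and g: "\<forall>\<sigma>\<in>\<Omega>. g \<sigma> = (\<Sum>i\<in>factors G. g\<^sub>\<Phi> i \<sigma>)"
    and g_dep: "\<forall>i\<in>factors G. depends_only_on (g\<^sub>\<Phi> i) \<Omega> (scope G i)"
    and \<nu>: "\<nu> = gibbs \<Omega> (\<lambda>\<sigma>. (\<Sum>i\<in>factors G. factor G i \<sigma>) + g \<sigma>)"
    and AT: "approx_tensorization s (verts G) \<mu> C\<^sub>A\<^sub>T"
  shows "(hellinger_dist \<Omega> \<nu> \<mu>)\<^sup>2 \<le> kl_div \<Omega> \<nu> \<mu> \<and>
         kl_div \<Omega> \<nu> \<mu> \<le>
           C\<^sub>A\<^sub>T * real (max_vertex_degree G) * real (max_factor_degree G) / 2
             * (\<Sum>i\<in>factors G. (half_osc \<Omega> (g\<^sub>\<Phi> i))\<^sup>2)"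
proof -
  let ?V = "verts G" and ?H = "\<lambda>\<sigma>. \<Sum>i\<in>factors G. factor G i \<sigma>"
  have fin_V: "finite ?V" and fin_F: "finite (factors G)"
    using G by (auto simp: is_factor_graph_def)
  have fin: "finite \<Omega>"
    unfolding \<Omega> configs_def using fin_V by (intro finite_PiE) auto
  have ne: "\<Omega> \<noteq> {}"
    using s by (auto simp: \<Omega> configs_def PiE_eq_empty_iff)
  define Z where "Z = (\<Sum>\<sigma>\<in>\<Omega>. exp (?H \<sigma>))"
  define Z' where "Z' = (\<Sum>\<sigma>\<in>\<Omega>. exp (?H \<sigma> + g \<sigma>))"
  have Z: "0 < Z" "0 < Z'"
    unfolding Z_def Z'_def using fin ne by (auto intro!: sum_pos)
  have pmf_\<mu>: "pmf \<mu> \<sigma> = (if \<sigma> \<in> \<Omega> then exp (?H \<sigma>) / Z else 0)" for \<sigma>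
    unfolding \<mu> Z_def using fin ne by (rule pmf_gibbs)
  have pmf_\<nu>: "pmf \<nu> \<sigma> = (if \<sigma> \<in> \<Omega> then exp (?H \<sigma> + g \<sigma>) / Z' else 0)" for \<sigma>
    unfolding \<nu> Z'_def using fin ne by (rule pmf_gibbs)
  have set_\<mu>: "set_pmf \<mu> = \<Omega>" and set_\<nu>: "set_pmf \<nu> = \<Omega>"
    using Z by (auto simp: set_pmf_eq pmf_\<mu> pmf_\<nu>)
  have hellinger: "(hellinger_dist \<Omega> \<nu> \<mu>)\<^sup>2 \<le> kl_div \<Omega> \<nu> \<mu>"
  proof (rule hellinger_dist_sq_le_kl_div)
    show "(\<Sum>\<sigma>\<in>\<Omega>. pmf \<nu> \<sigma>) = (\<Sum>\<sigma>\<in>\<Omega>. pmf \<mu> \<sigma>)"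
      using fin by (simp add: sum_pmf_eq_1 set_\<mu> set_\<nu>)
  qed (use Z in \<open>simp add: pmf_\<mu> pmf_\<nu>\<close>)

  \<comment> \<open>On \<open>\<Omega>\<close> this is the log-density of \<open>\<nu>\<close> with
    respect to \<open>\<mu>\<close>. It differs from \<open>g\<close> by a constant, so the two have
    the same oscillations.\<close>
  define h where "h = (\<lambda>\<sigma>. g \<sigma> - ln (Z' / Z))"
  have exp_h: "exp (h \<sigma>) = exp (g \<sigma>) * Z / Z'" for \<sigma>
    using Z by (simp add: h_def exp_diff)
  have dens: "pmf \<mu> \<sigma> * exp (h \<sigma>) = pmf \<nu> \<sigma>" if "\<sigma> \<in> \<Omega>" for \<sigma>
    using that Z by (simp add: pmf_\<mu> pmf_\<nu> exp_h exp_add)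
  have E: "measure_pmf.expectation \<mu> (\<lambda>\<sigma>. exp (h \<sigma>)) = 1"
    using fin by (simp add: expectation_finite set_\<mu> dens sum_pmf_eq_1 set_\<nu>)
  have ratio: "pmf \<nu> \<sigma> / pmf \<mu> \<sigma> = exp (h \<sigma>)" if "\<sigma> \<in> \<Omega>" for \<sigma>
    using that Z by (simp add: pmf_\<mu> pmf_\<nu> exp_h exp_add)
  have kl: "kl_div \<Omega> \<nu> \<mu> = global_ent \<mu> (\<lambda>\<sigma>. exp (h \<sigma>))"
    using fin unfolding global_ent_def E kl_div_def
    by (auto simp: expectation_finite set_\<mu> ratio simp flip: dens intro!: sum.cong)

  define \<delta> where "\<delta> = (\<lambda>i. half_osc \<Omega> (g\<^sub>\<Phi> i))"
  have osc: "h \<sigma> - h \<tau> \<le> 2 * (\<Sum>i\<in>factors_at G x. \<delta> i)"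
    if "\<sigma> \<in> \<Omega>" "\<tau> \<in> \<Omega>" "\<forall>y\<in>?V - {x}. \<sigma> y = \<tau> y" for \<sigma> \<tau> x
  proof -
    have "h \<sigma> - h \<tau> = (\<Sum>i\<in>factors G. g\<^sub>\<Phi> i \<sigma> - g\<^sub>\<Phi> i \<tau>)"
      using that g by (simp add: h_def sum_subtractf)
    \<comment> \<open>A factor whose scope avoids \<open>x\<close> sees only coordinates on which
      \<open>\<sigma>\<close> and \<open>\<tau>\<close> agree, so its term drops out.\<close>
    also have "\<dots> = (\<Sum>i\<in>factors_at G x. g\<^sub>\<Phi> i \<sigma> - g\<^sub>\<Phi> i \<tau>)"
    proof (rule sum.mono_neutral_right)
      show "\<forall>i\<in>factors G - factors_at G x. g\<^sub>\<Phi> i \<sigma> - g\<^sub>\<Phi> i \<tau> = 0"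
      proof
        fix i assume i: "i \<in> factors G - factors_at G x"
        then have "scope G i \<subseteq> ?V - {x}"
          using G by (auto simp: is_factor_graph_def factors_at_def)
        with that have "\<forall>y\<in>scope G i. \<sigma> y = \<tau> y" by blast
        with i g_dep that have "g\<^sub>\<Phi> i \<sigma> = g\<^sub>\<Phi> i \<tau>"
          unfolding depends_only_on_def by blast
        then show "g\<^sub>\<Phi> i \<sigma> - g\<^sub>\<Phi> i \<tau> = 0" by simp
      qed
    qed (use fin_F in \<open>auto simp: factors_at_def\<close>)
    also have "\<dots> \<le> (\<Sum>i\<in>factors_at G x. 2 * \<delta> i)"
      unfolding \<delta>_def using fin that by (intro sum_mono half_osc_bound)
    finally show ?thesis by (simp add: sum_distrib_left)
  qed

  have "kl_div \<Omega> \<nu> \<mu> \<le> C\<^sub>A\<^sub>T * (\<Sum>x\<in>?V. mean_local_ent ?V \<mu> {x} (\<lambda>\<sigma>. exp (h \<sigma>)))"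
    using AT by (simp add: kl approx_tensorization_def)
  moreover have "(\<Sum>x\<in>?V. mean_local_ent ?V \<mu> {x} (\<lambda>\<sigma>. exp (h \<sigma>)))
      \<le> (\<Sum>x\<in>?V. (\<Sum>i\<in>factors_at G x. \<delta> i)\<^sup>2 / 2)"
  proof (rule sum_mono)
    fix x assume "x \<in> ?V"
    then have "mean_local_ent ?V \<mu> {x} (\<lambda>\<sigma>. exp (h \<sigma>)) \<le> (\<Sum>i\<in>factors_at G x. \<delta> i)\<^sup>2 / 2
        * measure_pmf.expectation \<mu> (\<lambda>\<sigma>. exp (h \<sigma>))"
      using osc fin unfolding \<Omega>
      by (intro mean_local_ent_exp_le[where s = s]) (auto simp: set_\<mu> \<Omega>)
    then show "mean_local_ent ?V \<mu> {x} (\<lambda>\<sigma>. exp (h \<sigma>)) \<le> (\<Sum>i\<in>factors_at G x. \<delta> i)\<^sup>2 / 2"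
      by (simp add: E)
  qed
  moreover have "(\<Sum>x\<in>?V. (\<Sum>i\<in>factors_at G x. \<delta> i)\<^sup>2 / 2)
      \<le> real (max_vertex_degree G) * real (max_factor_degree G) * (\<Sum>i\<in>factors G. (\<delta> i)\<^sup>2) / 2"
    using sum_over_scopes_le[OF G, of \<delta>] by (simp flip: sum_divide_distrib)
  ultimately have nonneg_case: "kl_div \<Omega> \<nu> \<mu> \<le> C\<^sub>A\<^sub>T * (real (max_vertex_degree G)
      * real (max_factor_degree G) * (\<Sum>i\<in>factors G. (\<delta> i)\<^sup>2) / 2)" if "0 \<le> C\<^sub>A\<^sub>T"
    using that by (meson mult_left_mono order_trans)

  have "kl_div \<Omega> \<nu> \<mu> \<le> C\<^sub>A\<^sub>T * (real (max_vertex_degree G)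
      * real (max_factor_degree G) * (\<Sum>i\<in>factors G. (\<delta> i)\<^sup>2) / 2)"
  \<comment> \<open>Multiplying the local entropy bound by the constant needs its sign. A negative
    constant is possible only when \<open>\<Omega>\<close> is a single configuration, and then both
    sides are zero.\<close>
  proof (cases "0 \<le> C\<^sub>A\<^sub>T")
    case False
    obtain \<sigma> where \<sigma>: "\<sigma> \<in> \<Omega>" using ne by blast
    have "\<tau> = \<sigma>" if "\<tau> \<in> \<Omega>" for \<tau>
      using approx_tensorization_nonneg[OF AT, of \<tau> \<sigma>] False that \<sigma> fin set_\<mu> by (auto simp: \<Omega>)
    with \<sigma> have single: "\<Omega> = {\<sigma>}" by blast
    have "pmf \<nu> \<sigma> = 1" "pmf \<mu> \<sigma> = 1"
      using Z by (simp_all add: pmf_\<nu> pmf_\<mu> Z_def Z'_def single)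
    then have "kl_div \<Omega> \<nu> \<mu> = 0" by (simp add: kl_div_def single)
    moreover have "\<delta> i = 0" for i by (simp add: \<delta>_def half_osc_def single)
    ultimately show ?thesis by simp
  qed (rule nonneg_case)
  with hellinger show ?thesis by (simp add: \<delta>_def mult.assoc)
qed

end
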